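(* The Fano scheme of lines $F(V)$ of $V$, the variety of $3\times3$ magic squares of squares, is empty.
   Context: Let $V \subset \mathbb{P}^8_{\mathbb{Q}}$, with homogeneous coordinates $[A:B:C:D:M:E:F:G:H]$, be the variety of $3\times 3$ magic squares of squares, i.e. the variety defined by requiring all rows, columns and the two main diagonals of the array with rows $(A^2,B^2,C^2)$, $(D^2,M^2,E^2)$, $(F^2,G^2,H^2)$ to have sum $3M^2$. Equivalently, $V$ is the complete intersection surface defined by the six quadrics $3A^2-2F^2-2G^2+H^2$, $3B^2-2F^2+G^2-2H^2$, $3C^2+F^2-2G^2-2H^2$, $3D^2+2F^2-G^2-4H^2$, $3E^2-4F^2-G^2+2H^2$, $3M^2-F^2-G^2-H^2$. $F(V)\subset\mathbb{G}(1,8)$ is the closed subscheme of the Grassmannian of lines in $\mathbb{P}^8$ parametrizing lines contained in $V$; emptiness means that $V$ contains no lines over $\overline{\mathbb{Q}}$ (or $\mathbb{C}$). *)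

theory Defs
  imports "HOL-Analysis.Cartesian_Space"
begin

text \<open>
  Schemes over \<open>\<rat>\<close> are handled through their points over the extension fields of \<open>\<rat>\<close>,
  i.e. over the fields \<open>'k\<close> of characteristic 0: such a scheme is empty iff it has no
  \<open>'k\<close>-point for any such \<open>'k\<close>. A point of the projective space of \<open>'k^'n\<close> is represented by
  the corresponding one-dimensional subspace of \<open>'k^'n\<close>.
\<close>

definition proj_space :: "('k::field ^ 'n) set set" where
  "proj_space = {p. vec.subspace p \<and> vec.dim p = 1}"

text \<open>A projective line is represented by its affine cone, a two-dimensional subspace of \<open>'k^'n\<close>.\<close>

definition grassmannian_lines :: "('k::field ^ 'n) set set" where
  "grassmannian_lines = {L. vec.subspace L \<and> vec.dim L = 2}"

definition line_points :: "('k::field ^ 'n) set \<Rightarrow> ('k ^ 'n) set set" where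
  "line_points L = {p \<in> proj_space. p \<subseteq> L}"

text \<open>
  The \<open>'k\<close>-points of the Fano scheme of lines of a projective variety with set of
  \<open>'k\<close>-points \<open>X\<close>. Fields of characteristic 0 are infinite, so a form vanishes identically on a
  line as soon as it vanishes at all \<open>'k\<close>-points of the line; hence containment of
  \<open>'k\<close>-points is the same as containment of the line in the variety over \<open>'k\<close>.
\<close>

definition fano_lines :: "('k::field_char_0 ^ 'n) set set \<Rightarrow> ('k ^ 'n) set set" where
  "fano_lines X = {L \<in> grassmannian_lines. line_points L \<subseteq> X}"

text \<open>
  The homogeneous coordinates \<open>[A:B:C:D:M:E:F:G:H]\<close> are \<open>x $ 1, \<dots>, x $ 9\<close> in this order, the
  entries of the 3 by 3 array read row by row.
\<close>

definition magic_square_of_squares :: "'k::field_char_0 ^ 9 \<Rightarrow> bool" where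
  "magic_square_of_squares x \<longleftrightarrow>
    (let A = x $ 1; B = x $ 2; C = x $ 3;
         D = x $ 4; M = x $ 5; E = x $ 6;
         F = x $ 7; G = x $ 8; H = x $ 9
     in A^2 + B^2 + C^2 = 3 * M^2 \<and> D^2 + M^2 + E^2 = 3 * M^2 \<and> F^2 + G^2 + H^2 = 3 * M^2 \<and>
        A^2 + D^2 + F^2 = 3 * M^2 \<and> B^2 + M^2 + G^2 = 3 * M^2 \<and> C^2 + E^2 + H^2 = 3 * M^2 \<and>
        A^2 + M^2 + H^2 = 3 * M^2 \<and> C^2 + M^2 + F^2 = 3 * M^2)"

definition magic_variety :: "('k::field_char_0 ^ 9) set set" where
  "magic_variety = {p \<in> proj_space. \<forall>x\<in>p. magic_square_of_squares x}"

lemma magic_square_of_squares_iff_quadrics: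
  fixes x :: "'k::field_char_0 ^ 9"
  shows "magic_square_of_squares x \<longleftrightarrow>
    (let A = x $ 1; B = x $ 2; C = x $ 3;
         D = x $ 4; M = x $ 5; E = x $ 6;
         F = x $ 7; G = x $ 8; H = x $ 9
     in 3 * A^2 - 2 * F^2 - 2 * G^2 + H^2 = 0 \<and> 3 * B^2 - 2 * F^2 + G^2 - 2 * H^2 = 0 \<and>
        3 * C^2 + F^2 - 2 * G^2 - 2 * H^2 = 0 \<and> 3 * D^2 + 2 * F^2 - G^2 - 4 * H^2 = 0 \<and>
        3 * E^2 - 4 * F^2 - G^2 + 2 * H^2 = 0 \<and> 3 * M^2 - F^2 - G^2 - H^2 = 0)"
proof -
  have "(a + b + c = 3 * m \<and> d + m + e = 3 * m \<and> f + g + h = 3 * m \<and>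
         a + d + f = 3 * m \<and> b + m + g = 3 * m \<and> c + e + h = 3 * m \<and>
         a + m + h = 3 * m \<and> c + m + f = 3 * m) \<longleftrightarrow>
        (3 * a - 2 * f - 2 * g + h = 0 \<and> 3 * b - 2 * f + g - 2 * h = 0 \<and>
         3 * c + f - 2 * g - 2 * h = 0 \<and> 3 * d + 2 * f - g - 4 * h = 0 \<and>
         3 * e - 4 * f - g + 2 * h = 0 \<and> 3 * m - f - g - h = 0)"
    (is "?P \<longleftrightarrow> ?Q") for a b c d e f g h m :: 'k
  proof
    assume P: ?P
    have a: "a = 2 * m - h" using P by algebra
    have b: "b = 2 * m - g" using P by algebra
    have c: "c = 2 * m - f" using P by algebra
    have d: "d = 3 * m - a - f" using P by algebra
    have e: "e = 3 * m - c - h" using P by algebra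
    have m: "3 * m = f + g + h" using P by simp
    show ?Q unfolding d e unfolding a b c by (intro conjI) (use m in algebra)+
  next
    assume Q: ?Q
    have cancel: "u = v" if "3 * u = 3 * v" for u v :: 'k using that by simp
    have m: "3 * m = f + g + h" using Q by algebra
    have a: "3 * a = 2 * f + 2 * g - h" using Q by algebra
    have b: "3 * b = 2 * f - g + 2 * h" using Q by algebra
    have c: "3 * c = 2 * g + 2 * h - f" using Q by algebra
    have d: "3 * d = g + 4 * h - 2 * f" using Q by algebra
    have e: "3 * e = 4 * f + g - 2 * h" using Q by algebra
    show ?P
      by (intro conjI; rule cancel; simp only: distrib_left a b c d e m) (simp_all add: algebra_simps)
  qed
  then show ?thesis unfolding magic_square_of_squares_def Let_def by blast
qed

end

theory Submission
  imports Defs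
begin

text \<open>
  In a magic square of squares, each of the four pairs of entries opposite to the centre satisfies
  \<open>X\<^sup>2 + Y\<^sup>2 = 2 M\<^sup>2\<close>. On a line, the entries are linear forms in two parameters, and over an
  algebraically closed field this relation factors as \<open>(X + iY) (X - iY) = 2 M\<^sup>2\<close>. If \<open>M\<close> is not
  identically zero, unique factorization makes both factors, hence \<open>X\<close> and \<open>Y\<close>, multiples
  of \<open>M\<close>. Then all nine forms are multiples of \<open>M\<close>, and the zero of \<open>M\<close> on the line would be a
  point of projective space with all coordinates zero.

  If \<open>M\<close> vanishes identically, then \<open>A\<^sup>2 + C\<^sup>2 = G\<^sup>2\<close> remains, and the same argument applies to \<open>G\<close>,
  since \<open>A\<close> and \<open>C\<close> determine all other squares. If \<open>G\<close> vanishes too, every square is a multiple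
  of \<open>A\<^sup>2\<close>, and the zero of \<open>A\<close> on the line gives the contradiction.

  The factorization argument is carried out in \<open>sum_squares_proportional\<close> by polarization, which
  needs no square root of \<open>-1\<close> in the field; the zeros on the line come from
  \<open>coordinate_zero_on_line\<close>.
\<close>

lemma coordinate_zero_on_line:
  fixes L :: "('k::field ^ 'n) set"
  assumes L: "L \<in> grassmannian_lines"
  obtains w where "w \<in> L" "w \<noteq> 0" "w $ i = 0"
proof -
  have sub: "vec.subspace L" and dim: "vec.dim L = 2"
    using L by (auto simp: grassmannian_lines_def)
  have "\<not> L \<subseteq> {0}"
    using dim vec.dim_subset[of L "{0}"] vec.dim_le_card[of "{0}" "{}"] by auto
  then obtain u where u: "u \<in> L" "u \<noteq> 0" by blast
  have "\<not> L \<subseteq> vec.span {u}"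
    using dim vec.dim_le_card[of L "{u}"] by auto
  then obtain v where v: "v \<in> L" "v \<notin> vec.span {u}" by blast
  show thesis
  proof (cases "u $ i = 0")
    case True
    then show thesis using u that by blast
  next
    case False
    define c where "c = v $ i / u $ i"
    have "v - c *s u \<in> L"
      using sub u v by (intro vec.subspace_diff vec.subspace_scale)
    moreover have "v - c *s u \<noteq> 0"
    proof
      assume "v - c *s u = 0"
      then have "v = c *s u" by simp
      then show False using v(2) by (simp add: vec.span_base vec.span_scale)
    qed
    moreover have "(v - c *s u) $ i = 0" using False by (simp add: c_def)
    ultimately show thesis by (rule that)
  qed
qed

text \<open>
  This replaces unique factorization. At a zero \<open>w\<close> of the \<open>l\<close>-th coordinate, polarizing the
  relation shows that \<open>(w $ i, w $ j)\<close> is isotropic and orthogonal to \<open>(x $ i, x $ j)\<close>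
  for every \<open>x\<close>. In a nondegenerate plane, the vectors orthogonal to a nonzero isotropic vector are
  its multiples, so \<open>(x $ i, x $ j)\<close> is isotropic as well unless \<open>w $ i = w $ j = 0\<close>.
\<close>

lemma sum_squares_proportional:
  fixes L :: "('k::field_char_0 ^ 'n) set"
  assumes sub: "vec.subspace L" and k: "k \<noteq> 0"
    and rel: "\<And>x. x \<in> L \<Longrightarrow> (x $ i)^2 + (x $ j)^2 = k * (x $ l)^2"
    and w: "w \<in> L" "w $ l = 0" and x: "x \<in> L" "x $ l \<noteq> 0"
  shows "w $ i = 0 \<and> w $ j = 0"
proof -
  have iso: "(w $ i)^2 + (w $ j)^2 = 0" using rel[OF w(1)] w(2) by simp
  have "w + x \<in> L" using sub w x by (simp add: vec.subspace_add)
  from rel[OF this] have "(w $ i + x $ i)^2 + (w $ j + x $ j)^2 = k * (x $ l)^2"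
    using w(2) by simp
  then have "2 * (w $ i * x $ i + w $ j * x $ j) = 0"
    using iso rel[OF x(1)] by algebra
  then have orth: "w $ i * x $ i + w $ j * x $ j = 0"
    by (simp only: mult_eq_0_iff) simp
  have "(w $ i)^2 * (k * (x $ l)^2) = 0"
    using iso orth rel[OF x(1)] by algebra
  then have "w $ i = 0" using k x(2) by simp
  then show ?thesis using iso by simp
qed

lemma magic_on_fano_line:
  fixes L :: "('k::field_char_0 ^ 9) set"
  assumes L: "L \<in> fano_lines magic_variety" and x: "x \<in> L"
  shows "magic_square_of_squares x"
proof (cases "x = 0")
  case True
  then show ?thesis by (simp add: magic_square_of_squares_def)
next
  case False
  have "vec.subspace L" using L by (simp add: fano_lines_def grassmannian_lines_def)
  then have "vec.span {x} \<subseteq> L" using x by (simp add: vec.span_minimal)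
  moreover have "vec.dim (vec.span {x}) = 1"
    using False vec.dim_eq_card_independent[of "{x}"] by (simp add: vec.dim_span)
  ultimately have "vec.span {x} \<in> line_points L"
    by (simp add: line_points_def proj_space_def)
  then have "vec.span {x} \<in> magic_variety" using L by (auto simp: fano_lines_def)
  then show ?thesis by (simp add: magic_variety_def vec.span_base)
qed

lemma magic_opposite_entries:
  fixes x :: "'k::field_char_0 ^ 9"
  assumes "magic_square_of_squares x"
  shows "(x $ 1)^2 + (x $ 9)^2 = 2 * (x $ 5)^2" "(x $ 2)^2 + (x $ 8)^2 = 2 * (x $ 5)^2"
    "(x $ 3)^2 + (x $ 7)^2 = 2 * (x $ 5)^2" "(x $ 4)^2 + (x $ 6)^2 = 2 * (x $ 5)^2"
  using assms unfolding magic_square_of_squares_def Let_def by algebra+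

lemma magic_centre_zero:
  fixes x :: "'k::field_char_0 ^ 9"
  assumes "magic_square_of_squares x" "x $ 5 = 0"
  shows "(x $ 1)^2 + (x $ 3)^2 = 1 * (x $ 8)^2" "(x $ 4)^2 = (x $ 3)^2 - (x $ 1)^2"
  using assms unfolding magic_square_of_squares_def Let_def by algebra+

lemma vec_9_eq_0I:
  fixes x :: "'k::zero ^ 9"
  assumes "x $ 1 = 0" "x $ 2 = 0" "x $ 3 = 0" "x $ 4 = 0" "x $ 5 = 0"
    "x $ 6 = 0" "x $ 7 = 0" "x $ 8 = 0" "x $ 9 = 0"
  shows "x = 0"
proof -
  have "x $ i = 0" for i
  proof (cases i)
    case (of_int z)
    then have "z \<in> {0, 1, 2, 3, 4, 5, 6, 7, 8}" by auto
    moreover have "(0::9) = 9" by simp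
    then have "x $ 0 = 0" using assms(9) by metis
    ultimately show ?thesis using of_int assms by auto
  qed
  then show ?thesis by (simp add: vec_eq_iff)
qed

lemma magic_eq_0I:
  fixes x :: "'k::field_char_0 ^ 9"
  assumes magic: "magic_square_of_squares x" and zero: "x $ 1 = 0" "x $ 3 = 0" "x $ 5 = 0"
  shows "x = 0"
proof -
  have "x $ 8 = 0" "x $ 4 = 0"
    using magic_centre_zero[OF magic zero(3)] zero by simp_all
  then show ?thesis
    using magic_opposite_entries[OF magic] zero by (intro vec_9_eq_0I) simp_all
qed

theorem propositionA1:
  "fano_lines (magic_variety :: ('k::field_char_0 ^ 9) set set) = {}"
proof (rule equals0I)
  fix L :: "('k ^ 9) set"
  assume L: "L \<in> fano_lines magic_variety"
  then have line: "L \<in> grassmannian_lines" by (simp add: fano_lines_def)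
  then have sub: "vec.subspace L" by (simp add: grassmannian_lines_def)
  note magic = magic_on_fano_line[OF L]
  have M: "x $ 5 = 0" if "x \<in> L" for x
  proof (rule ccontr)
    assume x: "x $ 5 \<noteq> 0"
    obtain w where w: "w \<in> L" "w \<noteq> 0" "w $ 5 = 0"
      using coordinate_zero_on_line[OF line] .
    note vanish = sum_squares_proportional[OF sub _ _ w(1) w(3) that x, of 2]
    have "w $ 1 = 0"
      using vanish[of 1 9] magic_opposite_entries(1)[OF magic] by simp
    moreover have "w $ 3 = 0"
      using vanish[of 3 7] magic_opposite_entries(3)[OF magic] by simp
    ultimately show False using magic_eq_0I[OF magic] w by blast
  qed
  have G: "x $ 8 = 0" if "x \<in> L" for x
  proof (rule ccontr)
    assume x: "x $ 8 \<noteq> 0"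
    obtain w where w: "w \<in> L" "w \<noteq> 0" "w $ 8 = 0"
      using coordinate_zero_on_line[OF line] .
    have "w $ 1 = 0 \<and> w $ 3 = 0"
      by (rule sum_squares_proportional[OF sub one_neq_zero _ w(1) w(3) that x])
        (rule magic_centre_zero(1)[OF magic M])
    then show False using magic_eq_0I[OF magic] M w by blast
  qed
  obtain w where w: "w \<in> L" "w \<noteq> 0" "w $ 1 = 0"
    using coordinate_zero_on_line[OF line] .
  have "w $ 3 = 0"
    using magic_centre_zero(1)[OF magic M, OF w(1) w(1)] G[OF w(1)] w(3) by simp
  then show False using magic_eq_0I[OF magic] M w by blast
qed

end
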